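(* Let $P$ be a finite poset, $r\geq 1$ and $\imath:[r]\to[2r]$ strictly increasing. If the relation $\preceq'_\imath$ is a partial order on $P_r$, then the order complex of the poset $(P_r,\preceq'_\imath)$ is homotopy equivalent to the order complex $\Delta(P)$.
   Context: For a natural number $n$, $[n]=\{1,\dots,n\}$. $P_r$ denotes the set of all $r$-multichains $\mathfrak{p}: p_1\leq\cdots\leq p_r$ in $P$. For strictly increasing $\imath:[r]\to[2r]$, $\mathfrak{p}\preceq_\imath\mathfrak{q}$ (for $\mathfrak{p}: p_1\leq\cdots\leq p_r$, $\mathfrak{q}: q_1\leq\cdots\leq q_r$) means: for all $t,s\in[r]$, $p_t\geq q_s$ whenever $s\leq\imath(t)-t$ and $p_t\leq q_s$ whenever $s>\imath(t)-t$. The relation $\preceq'_\imath$ is defined by $\mathfrak{p}\preceq'_\imath\mathfrak{q}$ iff $\mathfrak{p}=\mathfrak{q}$, or $\mathfrak{p}\neq\mathfrak{q}$ and $\mathfrak{p}\preceq_\imath\mathfrak{q}$. Order complexes consist of all chains of the poset; homotopy equivalence refers to geometric realizations. *)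

theory Defs
  imports "HOL-Analysis.Analysis"
begin

text \<open>
  Posets are given by a carrier \<open>P\<close> and a relation \<open>R\<close> with \<^term>\<open>partial_order_on P R\<close>.
\<close>

text \<open>
  A multichain \<open>p\<^sub>1 \<le> \<dots> \<le> p\<^sub>r\<close> is the function \<open>t \<mapsto> p\<^sub>t\<close> on \<open>{1..r}\<close>. It is taken to be
  extensional, so that equality of functions is equality of multichains.
\<close>

definition multichains :: "'a set \<Rightarrow> 'a rel \<Rightarrow> nat \<Rightarrow> (nat \<Rightarrow> 'a) set" where
  "multichains P R r =
     {p \<in> {1..r} \<rightarrow>\<^sub>E P. \<forall>s\<in>{1..r}. \<forall>t\<in>{1..r}. s \<le> t \<longrightarrow> (p s, p t) \<in> R}"

text \<open>
  The subtraction on \<^typ>\<open>nat\<close> is never truncated for the \<open>\<iota>\<close> of interest: a strictly increasing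
  \<open>\<iota> : {1..r} \<rightarrow> {1..2 * r}\<close> satisfies \<open>t \<le> \<iota> t\<close>.
\<close>

definition multichain_prec ::
    "'a rel \<Rightarrow> nat \<Rightarrow> (nat \<Rightarrow> nat) \<Rightarrow> (nat \<Rightarrow> 'a) \<Rightarrow> (nat \<Rightarrow> 'a) \<Rightarrow> bool" where
  "multichain_prec R r \<iota> p q \<longleftrightarrow>
     (\<forall>t\<in>{1..r}. \<forall>s\<in>{1..r}.
        (s \<le> \<iota> t - t \<longrightarrow> (q s, p t) \<in> R) \<and>
        (s > \<iota> t - t \<longrightarrow> (p t, q s) \<in> R))"

definition multichain_rel ::
    "'a set \<Rightarrow> 'a rel \<Rightarrow> nat \<Rightarrow> (nat \<Rightarrow> nat) \<Rightarrow> (nat \<Rightarrow> 'a) rel" where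
  "multichain_rel P R r \<iota> =
     {(p, q). p \<in> multichains P R r \<and> q \<in> multichains P R r \<and>
              (p = q \<or> p \<noteq> q \<and> multichain_prec R r \<iota> p q)}"

text \<open>As is usual for abstract simplicial complexes, the empty chain is a face.\<close>

definition order_complex :: "'a set \<Rightarrow> 'a rel \<Rightarrow> 'a set set" where
  "order_complex P R = {C. C \<subseteq> P \<and> finite C \<and> C \<in> Chains R}"

text \<open>
  The realization by barycentric coordinates: points are the convex weights on the vertices
  whose support is a face. The topology is that of \<open>\<real>\<^sup>V\<close> with \<open>V\<close> the vertex set \<open>\<Union>K\<close>; this is
  the usual (weak) topology only for finite complexes \<open>K\<close>, the only ones needed here. The empty
  face contributes no point, so the realization of \<open>{{}}\<close> is the empty space.
\<close>

definition geometric_realization :: "'v set set \<Rightarrow> ('v \<Rightarrow> real) topology" where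
  "geometric_realization K =
     subtopology (powertop_real (\<Union>K))
       {x. (\<forall>v\<in>\<Union>K. 0 \<le> x v) \<and> {v \<in> \<Union>K. x v \<noteq> 0} \<in> K \<and> (\<Sum>v\<in>\<Union>K. x v) = 1}"

end

theory Submission
  imports Defs
begin

text \<open>
  Everything rests on one elementary move: if the link of a face \<open>\<sigma>\<close> is a cone with apex \<open>a\<close>, then
  deleting \<open>\<sigma>\<close> and all faces above it keeps the homotopy type, because the weight common to the
  vertices of \<open>\<sigma>\<close> can be moved to \<open>a\<close>. Applied to the mapping cylinder of a monotone map, such
  moves give a fibre theorem in the style of Quillen.

  Put \<open>j t = \<iota> t - t\<close>, a weakly increasing function with values in \<open>{0..r}\<close>. As soon as \<open>P\<close> has two
  comparable elements, the partial order hypothesis forces \<open>j b = b\<close> (if \<open>b \<ge> 1\<close>) and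
  \<open>j (b + 1) = b\<close> (if \<open>b < r\<close>) for all values \<open>b\<close> of \<open>j\<close>. Restricting multichains to the coordinates
  \<open>b\<close> and \<open>b + 1\<close> then is a monotone map onto multichains ordered coordinatewise, with the order
  reversed at the coordinates \<open>b\<close>; its fibres have least elements. In the target the last coordinate
  can be forgotten, the fibres being conically contractible, until one coordinate is left and the
  poset is \<open>P\<close> or its opposite.
\<close>

subsection \<open>Deleting faces with conical link\<close>

text \<open>Finiteness of the vertex set is built in, since the realization uses the product
  topology and a sum over all vertices.\<close>

definition simplicial :: "'v set set \<Rightarrow> bool" where
  "simplicial K \<longleftrightarrow> finite (\<Union>K) \<and> (\<forall>\<tau>\<in>K. \<forall>\<rho>. \<rho> \<subseteq> \<tau> \<longrightarrow> \<rho> \<in> K)"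

section \<open>Points and coordinates of the realization\<close>

lemma topspace_geometric_realization:
  "x \<in> topspace (geometric_realization K) \<longleftrightarrow>
     x \<in> extensional (\<Union>K) \<and> (\<forall>v\<in>\<Union>K. 0 \<le> x v) \<and> {v \<in> \<Union>K. x v \<noteq> 0} \<in> K \<and> (\<Sum>v\<in>\<Union>K. x v) = 1"
  unfolding geometric_realization_def by (auto simp: PiE_def)

lemma continuous_map_into_geometric_realization:
  assumes "\<And>v. v \<in> \<Union>K \<Longrightarrow> continuous_map X euclideanreal (\<lambda>x. f x v)"
    and "\<And>x. x \<in> topspace X \<Longrightarrow> f x \<in> topspace (geometric_realization K)"
  shows "continuous_map X (geometric_realization K) f"
  using assms unfolding geometric_realization_def continuous_map_in_subtopology continuous_map_componentwise
  by (auto simp: PiE_iff Ball_def Pi_iff)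

lemma continuous_map_geometric_realization_coord:
  assumes "v \<in> \<Union>K"
  shows "continuous_map (geometric_realization K) euclideanreal (\<lambda>x. x v)"
  unfolding geometric_realization_def
  by (intro continuous_map_from_subtopology continuous_map_product_projection assms)

lemma continuous_map_Min_image:
  fixes f :: "'i \<Rightarrow> 'a \<Rightarrow> real"
  assumes "finite I" "I \<noteq> {}" "\<And>i. i \<in> I \<Longrightarrow> continuous_map X euclideanreal (f i)"
  shows "continuous_map X euclideanreal (\<lambda>x. Min ((\<lambda>i. f i x) ` I))"
  using assms
proof (induction rule: finite_ne_induct)
  case (singleton i)
  then show ?case by (simp add: eta_contract_eq)
next
  case (insert i I)
  have "continuous_map X euclideanreal (\<lambda>x. min (f i x) (Min ((\<lambda>i. f i x) ` I)))"
    using insert by (intro continuous_map_real_min) auto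
  moreover have "Min ((\<lambda>j. f j x) ` insert i I) = min (f i x) (Min ((\<lambda>i. f i x) ` I))" for x
    using insert by simp
  ultimately show ?case by simp
qed

text \<open>The family \<open>h t\<close> deforms the identity into a map \<open>h 1\<close> after
  which no support contains \<open>\<sigma>\<close>. So \<open>f\<close>, which corestricts
  \<open>h 1\<close>, and \<open>g\<close>, extension by zero, are inverse up to homotopy;
  \<open>f \<circ> g\<close> is even the identity, because the common weight \<open>m\<close>
  already vanishes on the smaller complex.\<close>

lemma homotopy_equivalent_delete_face:
  fixes K :: "'v set set"
  assumes K: "simplicial K" and ne: "\<sigma> \<noteq> {}" and a: "a \<notin> \<sigma>"
    and cone: "\<And>\<tau>. \<tau> \<in> K \<Longrightarrow> \<sigma> \<subseteq> \<tau> \<Longrightarrow> insert a \<tau> \<in> K"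
  shows "geometric_realization K homotopy_equivalent_space
         geometric_realization {\<tau> \<in> K. \<not> \<sigma> \<subseteq> \<tau>}"
proof (cases "\<sigma> \<in> K")
  case False
  then have "{\<tau> \<in> K. \<not> \<sigma> \<subseteq> \<tau>} = K"
    using K unfolding simplicial_def by auto
  then show ?thesis by (simp add: homotopy_equivalent_space_refl)
next
  case True
  define V where "V = \<Union>K"
  define K' where "K' = {\<tau> \<in> K. \<not> \<sigma> \<subseteq> \<tau>}"
  define V' where "V' = \<Union>K'"
  \<comment> \<open>\<open>h\<close> moves the fraction \<open>t\<close> of the common weight \<open>m\<close> of the vertices of \<open>\<sigma>\<close> to \<open>a\<close>.\<close>
  define m where "m x = Min ((\<lambda>v. x v) ` \<sigma>)" for x :: "'v \<Rightarrow> real"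
  define D where "D v = (if v = a then real (card \<sigma>) else 0) - (if v \<in> \<sigma> then 1 else 0)" for v
  define h where "h t x = (\<lambda>v\<in>V. x v + t * m x * D v)" for t and x :: "'v \<Rightarrow> real"
  \<comment> \<open>The vertex sets differ exactly when \<open>\<sigma>\<close> is a single vertex,
    which then disappears; for this case \<open>f\<close> restricts and \<open>g\<close> pads with
    0.\<close>
  define f where "f x = restrict (h 1 x) V'" for x
  define g where "g y = (\<lambda>v\<in>V. if v \<in> V' then y v else 0)" for y :: "'v \<Rightarrow> real"
  have down: "\<rho> \<in> K" if "\<rho> \<subseteq> \<tau>" "\<tau> \<in> K" for \<rho> \<tau>
    using K that unfolding simplicial_def by blast
  have finV: "finite V" using K unfolding simplicial_def V_def by blast
  have \<sigma>V: "\<sigma> \<subseteq> V" using True V_def by blast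
  have aV: "a \<in> V" using cone[OF True] V_def by blast
  have fin\<sigma>: "finite \<sigma>" using finV \<sigma>V finite_subset by blast
  have V'V: "V' \<subseteq> V" unfolding V'_def V_def K'_def by blast
  have topK: "x \<in> topspace (geometric_realization K) \<longleftrightarrow>
      x \<in> extensional V \<and> (\<forall>v\<in>V. 0 \<le> x v) \<and> {v \<in> V. x v \<noteq> 0} \<in> K \<and> (\<Sum>v\<in>V. x v) = 1" for x
    unfolding V_def by (rule topspace_geometric_realization)
  have topK': "x \<in> topspace (geometric_realization K') \<longleftrightarrow>
      x \<in> extensional V' \<and> (\<forall>v\<in>V'. 0 \<le> x v) \<and> {v \<in> V'. x v \<noteq> 0} \<in> K' \<and> (\<Sum>v\<in>V'. x v) = 1" for x
    unfolding V'_def by (rule topspace_geometric_realization)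
  have m_le: "m x \<le> x v" if "v \<in> \<sigma>" for x v
    unfolding m_def using that fin\<sigma> by simp
  have m_attained: "\<exists>v\<in>\<sigma>. x v = m x" for x
  proof -
    have "m x \<in> (\<lambda>v. x v) ` \<sigma>"
      unfolding m_def using fin\<sigma> ne by (intro Min_in) auto
    then show ?thesis by auto
  qed
  have m_nonneg: "m x \<ge> 0" if "\<forall>v\<in>V. 0 \<le> x v" for x
    using m_attained[of x] that \<sigma>V by (metis subsetD)
  \<comment> \<open>The apex gains one unit from each vertex of \<open>\<sigma>\<close>, so the
    total weight is kept.\<close>
  have sumD: "(\<Sum>v\<in>V. D v) = 0"
  proof -
    have "(\<Sum>v\<in>V. if v \<in> \<sigma> then 1 else 0 :: real) = real (card \<sigma>)"
      using sum.inter_restrict[OF finV, of "\<lambda>_. 1::real" \<sigma>] \<sigma>V by (simp add: inf_absorb2)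
    then show ?thesis
      unfolding D_def sum_subtractf using finV aV by simp
  qed
  have h_top: "h t x \<in> topspace (geometric_realization K)"
    if x: "x \<in> topspace (geometric_realization K)" and t: "0 \<le> t" "t \<le> 1" for t x
  proof -
    have x': "\<forall>v\<in>V. 0 \<le> x v" "{v \<in> V. x v \<noteq> 0} \<in> K" "(\<Sum>v\<in>V. x v) = 1"
      using x topK by auto
    have m0: "0 \<le> m x" using m_nonneg x' by blast
    have "0 \<le> h t x v" if "v \<in> V" for v
    proof (cases "v \<in> \<sigma>")
      case True
      have "t * m x \<le> 1 * m x" using t m0 by (intro mult_right_mono) auto
      then show ?thesis using True a m_le[OF True, of x] that by (auto simp: h_def D_def)
    next
      case False
      then show ?thesis using x' m0 t that by (auto simp: h_def D_def)
    qed
    moreover have "{v \<in> V. h t x v \<noteq> 0} \<in> K"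
    proof (cases "m x = 0")
      case True
      then have "{v \<in> V. h t x v \<noteq> 0} = {v \<in> V. x v \<noteq> 0}" by (auto simp: h_def)
      then show ?thesis using x' by simp
    next
      case False
      \<comment> \<open>If \<open>m x\<close> is positive, the support contains
        \<open>\<sigma>\<close>, so it stays a face when \<open>a\<close> joins.\<close>
      then have \<sigma>x: "\<sigma> \<subseteq> {v \<in> V. x v \<noteq> 0}"
        using m0 m_le[of _ x] \<sigma>V by force
      then have "insert a {v \<in> V. x v \<noteq> 0} \<in> K" using cone x' by blast
      moreover have "{v \<in> V. h t x v \<noteq> 0} \<subseteq> insert a {v \<in> V. x v \<noteq> 0}"
        using \<sigma>x by (auto simp: h_def D_def split: if_splits)
      ultimately show ?thesis using down by blast
    qed
    moreover have "(\<Sum>v\<in>V. h t x v) = 1"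
      using x' sumD by (simp add: h_def sum.distrib flip: sum_distrib_left)
    ultimately show ?thesis unfolding topK by (simp add: h_def)
  qed
  have h1: "{v \<in> V. h 1 x v \<noteq> 0} \<in> K'" if x: "x \<in> topspace (geometric_realization K)" for x
  proof -
    \<comment> \<open>A vertex of \<open>\<sigma>\<close> of minimal weight has lost all of it at
      time 1.\<close>
    obtain v where "v \<in> \<sigma>" "x v = m x" using m_attained by blast
    then have "h 1 x v = 0" using \<sigma>V a by (auto simp: h_def D_def)
    then show ?thesis
      using h_top[OF x, of 1] \<open>v \<in> \<sigma>\<close> unfolding K'_def topK by auto
  qed
  have f_top: "f x \<in> topspace (geometric_realization K')"
    and gf: "g (f x) = h 1 x" if x: "x \<in> topspace (geometric_realization K)" for x
  proof -
    have hx: "h 1 x \<in> extensional V" "\<forall>v\<in>V. 0 \<le> h 1 x v" "(\<Sum>v\<in>V. h 1 x v) = 1"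
      using h_top[OF x, of 1] topK by auto
    have out: "h 1 x v = 0" if "v \<in> V" "v \<notin> V'" for v
      using h1[OF x] that unfolding V'_def by blast
    have "(\<Sum>v\<in>V'. h 1 x v) = (\<Sum>v\<in>V. h 1 x v)"
      using finV V'V out by (intro sum.mono_neutral_left) auto
    moreover have "{v \<in> V'. f x v \<noteq> 0} = {v \<in> V. h 1 x v \<noteq> 0}"
      using V'V out by (auto simp: f_def)
    ultimately show "f x \<in> topspace (geometric_realization K')"
      unfolding topK' using hx h1[OF x] V'V by (auto simp: f_def)
    show "g (f x) = h 1 x"
      using hx out unfolding g_def f_def by (auto simp: extensional_def fun_eq_iff)
  qed
  have g_top: "g y \<in> topspace (geometric_realization K)"
    and fg: "f (g y) = y" if y: "y \<in> topspace (geometric_realization K')" for y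
  proof -
    have y': "y \<in> extensional V'" "\<forall>v\<in>V'. 0 \<le> y v" "{v \<in> V'. y v \<noteq> 0} \<in> K'" "(\<Sum>v\<in>V'. y v) = 1"
      using y topK' by auto
    have supp: "{v \<in> V. g y v \<noteq> 0} = {v \<in> V'. y v \<noteq> 0}"
      using V'V by (auto simp: g_def)
    have "(\<Sum>v\<in>V. g y v) = (\<Sum>v\<in>V'. g y v)"
      using finV V'V by (intro sum.mono_neutral_right) (auto simp: g_def)
    also have "\<dots> = (\<Sum>v\<in>V'. y v)"
      using V'V by (intro sum.cong) (auto simp: g_def)
    finally show "g y \<in> topspace (geometric_realization K)"
      unfolding topK supp using y' by (auto simp: g_def K'_def)
    have nn: "\<forall>v\<in>V. 0 \<le> g y v" using y' by (auto simp: g_def)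
    \<comment> \<open>Some vertex of \<open>\<sigma>\<close> is missing from the support of
      \<open>g y\<close>, hence \<open>m (g y) = 0\<close> and \<open>h\<close> does not move
      \<open>g y\<close>.\<close>
    obtain v where "v \<in> \<sigma>" "v \<notin> {v \<in> V. g y v \<noteq> 0}"
      using y'(3) unfolding supp K'_def by blast
    then have "g y v = 0" using \<sigma>V by blast
    then have "m (g y) = 0" using m_le[OF \<open>v \<in> \<sigma>\<close>, of "g y"] m_nonneg[OF nn] by simp
    then show "f (g y) = y"
      using y'(1) V'V unfolding f_def h_def by (auto simp: fun_eq_iff extensional_def g_def)
  qed
  have cont_m: "continuous_map (geometric_realization K) euclideanreal m"
    unfolding m_def using \<sigma>V fin\<sigma> ne V_def
    by (intro continuous_map_Min_image continuous_map_geometric_realization_coord) auto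
  have f_cont: "continuous_map (geometric_realization K) (geometric_realization K') f"
  proof (rule continuous_map_into_geometric_realization)
    fix v assume v: "v \<in> \<Union>K'"
    then have v': "v \<in> V'" "v \<in> V" "v \<in> \<Union>K" using V'V unfolding V'_def V_def by auto
    have "continuous_map (geometric_realization K) euclideanreal (\<lambda>x. x v + 1 * m x * D v)"
      by (intro continuous_intros cont_m continuous_map_geometric_realization_coord v') simp_all
    then show "continuous_map (geometric_realization K) euclideanreal (\<lambda>x. f x v)"
      using v' by (simp add: f_def h_def)
  qed (rule f_top)
  have g_cont: "continuous_map (geometric_realization K') (geometric_realization K) g"
  proof (rule continuous_map_into_geometric_realization)
    fix v assume v: "v \<in> \<Union>K"
    show "continuous_map (geometric_realization K') euclideanreal (\<lambda>x. g x v)"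
    proof (cases "v \<in> V'")
      case True
      then show ?thesis
        using v continuous_map_geometric_realization_coord[of v K']
        by (simp add: g_def V_def V'_def)
    next
      case False
      then show ?thesis using v by (simp add: g_def V_def)
    qed
  qed (rule g_top)
  have "homotopic_with (\<lambda>x. True) (geometric_realization K) (geometric_realization K) (h 1) (h 0)"
  proof (rule homotopic_with_symD)
    let ?I = "prod_topology (top_of_set {0..1::real}) (geometric_realization K)"
    have "continuous_map ?I (geometric_realization K) (\<lambda>z. h (fst z) (snd z))"
    proof (rule continuous_map_into_geometric_realization)
      fix v assume v: "v \<in> \<Union>K"
      have "continuous_map ?I euclideanreal (\<lambda>z. snd z v + fst z * m (snd z) * D v)"
      proof (intro continuous_intros)
        show "continuous_map ?I euclideanreal (\<lambda>z. snd z v)"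
          using continuous_map_compose[OF continuous_map_snd continuous_map_geometric_realization_coord[OF v]]
          by (simp add: comp_def)
        show "continuous_map ?I euclideanreal (\<lambda>z. m (snd z))"
          using continuous_map_compose[OF continuous_map_snd cont_m] by (simp add: comp_def)
        show "continuous_map ?I euclideanreal fst"
          using continuous_map_fst[of "top_of_set {0..1::real}"] continuous_map_into_fulltopology by blast
      qed simp_all
      then show "continuous_map ?I euclideanreal (\<lambda>z. h (fst z) (snd z) v)"
        using v by (simp add: h_def V_def)
    next
      show "h (fst z) (snd z) \<in> topspace (geometric_realization K)" if "z \<in> topspace ?I" for z
        using that h_top by auto
    qed
    then show "homotopic_with (\<lambda>x. True) (geometric_realization K) (geometric_realization K) (h 0) (h 1)"
      unfolding homotopic_with_def by fastforce
  qed
  then have "homotopic_with (\<lambda>x. True) (geometric_realization K) (geometric_realization K) (g \<circ> f) id"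
  proof (rule homotopic_with_eq)
    show "id x = h 0 x" if "x \<in> topspace (geometric_realization K)" for x
      using that unfolding topK h_def by (auto simp: extensional_def fun_eq_iff)
  qed (simp_all add: gf)
  moreover have "homotopic_with (\<lambda>x. True) (geometric_realization K') (geometric_realization K') (f \<circ> g) id"
    using fg f_cont g_cont by (intro homotopic_with_equal continuous_map_compose) auto
  ultimately show ?thesis
    unfolding homotopy_equivalent_space_def K'_def[symmetric]
    using f_cont g_cont by blast
qed

text \<open>Renaming only relabels barycentric coordinates, so it is a homeomorphism. It identifies
  the two ends of a mapping cylinder, which are tagged copies in a sum type, with the posets
  themselves.\<close>

lemma homotopy_equivalent_rename:
  assumes inj: "inj_on h (\<Union>K)"
  shows "geometric_realization ((`) h ` K) homotopy_equivalent_space geometric_realization K"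
proof (rule homeomorphic_imp_homotopy_equivalent_space)
  define L where "L = (`) h ` K"
  define V where "V = \<Union>K"
  define k where "k = inv_into V h"
  have UL: "\<Union>L = h ` V" unfolding L_def V_def by blast
  have kh: "k (h v) = v" if "v \<in> V" for v
    using inj that unfolding k_def V_def by simp
  have injV: "inj_on h V" using inj V_def by simp
  define F where "F x = (\<lambda>w\<in>h ` V. x (k w))" for x :: "'a \<Rightarrow> real"
  define G where "G y = (\<lambda>v\<in>V. y (h v))" for y :: "'b \<Rightarrow> real"
  have supp: "{w \<in> h ` V. F x w \<noteq> 0} = h ` {v \<in> V. x v \<noteq> 0}" for x
    using kh by (force simp: F_def)
  have mem: "S \<in> K" if S: "S \<subseteq> V" "h ` S \<in> L" for S
  proof -
    obtain T where T: "T \<in> K" "h ` S = h ` T" using S(2) unfolding L_def by blast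
    then have "T \<subseteq> V" unfolding V_def by blast
    then show ?thesis using T inj_on_image_eq_iff[OF injV S(1)] by simp
  qed
  have F_top: "F x \<in> topspace (geometric_realization L)"
    if "x \<in> topspace (geometric_realization K)" for x
  proof -
    have "(\<Sum>w\<in>h ` V. F x w) = (\<Sum>v\<in>V. x v)"
      using injV by (simp add: sum.reindex F_def kh)
    then show ?thesis
      using that unfolding topspace_geometric_realization UL supp V_def[symmetric]
      by (auto simp: F_def kh L_def)
  qed
  have G_top: "G y \<in> topspace (geometric_realization K)"
    if "y \<in> topspace (geometric_realization L)" for y
  proof -
    have "(\<Sum>v\<in>V. G y v) = (\<Sum>w\<in>h ` V. y w)"
      using injV by (simp add: sum.reindex G_def)
    moreover have "{w \<in> h ` V. y w \<noteq> 0} = h ` {v \<in> V. G y v \<noteq> 0}"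
      by (auto simp: G_def)
    moreover have "{v \<in> V. G y v \<noteq> 0} \<in> K"
      using that calculation(2) unfolding topspace_geometric_realization UL
      by (intro mem) auto
    ultimately show ?thesis
      using that unfolding topspace_geometric_realization UL V_def[symmetric]
      by (auto simp: G_def)
  qed
  have "continuous_map (geometric_realization L) (geometric_realization K) G"
  proof (rule continuous_map_into_geometric_realization[OF _ G_top])
    fix v assume "v \<in> \<Union>K"
    then show "continuous_map (geometric_realization L) euclideanreal (\<lambda>y. G y v)"
      using continuous_map_geometric_realization_coord[of "h v" L] UL
      by (simp add: G_def V_def)
  qed
  moreover have "continuous_map (geometric_realization K) (geometric_realization L) F"
  proof (rule continuous_map_into_geometric_realization[OF _ F_top])
    fix w assume "w \<in> \<Union>L"
    then have w: "w \<in> h ` V" using UL by simp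
    then have "k w \<in> V" using kh by auto
    then show "continuous_map (geometric_realization K) euclideanreal (\<lambda>x. F x w)"
      using continuous_map_geometric_realization_coord[of "k w" K] w by (simp add: F_def V_def)
  qed
  moreover have "F (G y) = y" if "y \<in> topspace (geometric_realization L)" for y
    using that unfolding topspace_geometric_realization UL
    by (auto simp: F_def G_def kh extensional_def fun_eq_iff)
  moreover have "G (F x) = x" if "x \<in> topspace (geometric_realization K)" for x
    using that unfolding topspace_geometric_realization V_def[symmetric]
    by (auto simp: F_def G_def kh extensional_def fun_eq_iff)
  ultimately show "geometric_realization ((`) h ` K) homeomorphic_space geometric_realization K"
    unfolding homeomorphic_space_def homeomorphic_maps_def L_def[symmetric] by blast
qed

subsection \<open>A fibre theorem for order complexes\<close>

text \<open>Elements are removed from the bottom up: \<open>x\<close> is minimal in the current set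
  \<open>S\<close>, not necessarily in \<open>A\<close>. Applied to a converse relation this removes
  maximal elements first.\<close>

lemma finite_poset_induct [consumes 3, case_names empty minimal]:
  assumes "finite A" "antisym r" "trans r"
    and "P {}"
    and step: "\<And>S x. S \<subseteq> A \<Longrightarrow> x \<in> S \<Longrightarrow> (\<And>z. z \<in> S \<Longrightarrow> (z, x) \<in> r \<Longrightarrow> z = x) \<Longrightarrow> P (S - {x}) \<Longrightarrow> P S"
  shows "P A"
proof -
  have "P S" if "S \<subseteq> A" "finite S" for S
    using that(2,1)
  proof (induction S rule: finite_psubset_induct)
    case (psubset S)
    show ?case
    proof (cases "S = {}")
      case False
      let ?L = "\<lambda>a b. (a, b) \<in> r \<and> a \<noteq> b"
      have "asymp_on S ?L" "transp_on S ?L"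
        using assms(2,3) by (auto intro!: asymp_onI transp_onI dest: antisymD transD)
      then obtain x where x: "x \<in> S" "\<forall>z\<in>S. z \<noteq> x \<longrightarrow> \<not> ?L z x"
        using Finite_Set.bex_min_element[OF psubset(1) _ _ False] by blast
      then have "P (S - {x})" using psubset by blast
      then show ?thesis using step[of S x] x psubset by blast
    qed (use \<open>P {}\<close> in simp)
  qed
  then show ?thesis using assms(1) by blast
qed

text \<open>
  Quillen's condition \<open>x \<ge> g x\<close> with all \<open>g x\<close> comparable to one point \<open>w\<close>. Idempotence of \<open>g\<close> and
  \<open>g w = w\<close> are included because the fibres are dismantled one point at a time, retaining only the
  fixed points of \<open>g\<close>.
\<close>
definition conically_contractible :: "'a set \<Rightarrow> 'a rel \<Rightarrow> bool" where
  "conically_contractible F r \<longleftrightarrow>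
     (\<exists>g w. w \<in> F \<and> g w = w \<and>
        (\<forall>x\<in>F. g x \<in> F \<and> g (g x) = g x \<and> (g x, x) \<in> r \<and> ((g x, w) \<in> r \<or> (w, g x) \<in> r)) \<and>
        (\<forall>x\<in>F. \<forall>x'\<in>F. (x, x') \<in> r \<longrightarrow> (g x, g x') \<in> r))"

lemma conically_contractible_least:
  assumes "w \<in> F" "\<And>x. x \<in> F \<Longrightarrow> (w, x) \<in> r"
  shows "conically_contractible F r"
  unfolding conically_contractible_def
  by (rule exI[of _ "\<lambda>_. w"], rule exI[of _ w]) (use assms in auto)

section \<open>Order complexes as simplicial complexes\<close>

lemma simplicial_order_complex:
  assumes "finite A"
  shows "simplicial (order_complex A r)"
proof -
  have "\<Union>(order_complex A r) \<subseteq> A" unfolding order_complex_def by blast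
  then have "finite (\<Union>(order_complex A r))" by (rule finite_subset) (rule assms)
  moreover have "\<rho> \<in> order_complex A r" if "\<tau> \<in> order_complex A r" "\<rho> \<subseteq> \<tau>" for \<rho> \<tau>
    using that finite_subset[of \<rho> \<tau>] unfolding order_complex_def Chains_def by blast
  ultimately show ?thesis
    unfolding simplicial_def by blast
qed

lemma simplicial_Collect:
  assumes "simplicial K" "\<And>\<rho> \<tau>. \<rho> \<subseteq> \<tau> \<Longrightarrow> Q \<tau> \<Longrightarrow> Q \<rho>"
  shows "simplicial {\<tau> \<in> K. Q \<tau>}"
proof -
  have "finite (\<Union>{\<tau> \<in> K. Q \<tau>})"
    using assms(1) finite_subset[of "\<Union>{\<tau> \<in> K. Q \<tau>}" "\<Union>K"] unfolding simplicial_def by blast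
  then show ?thesis using assms unfolding simplicial_def by blast
qed

lemma insert_order_complex:
  assumes "C \<in> order_complex A r" "a \<in> A" "(a, a) \<in> r"
    and "\<And>b. b \<in> C \<Longrightarrow> (a, b) \<in> r \<or> (b, a) \<in> r"
  shows "insert a C \<in> order_complex A r"
  using assms unfolding order_complex_def Chains_def by blast

lemma order_complexD:
  assumes "C \<in> order_complex A r" "a \<in> C" "b \<in> C"
  shows "a \<in> A" "(a, b) \<in> r \<or> (b, a) \<in> r"
  using assms unfolding order_complex_def Chains_def by auto

lemma order_complex_image:
  assumes "finite A" "inj h" "\<And>a b. a \<in> A \<Longrightarrow> b \<in> A \<Longrightarrow> (h a, h b) \<in> s \<longleftrightarrow> (a, b) \<in> r"
  shows "order_complex (h ` A) s = (`) h ` order_complex A r"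
proof (intro equalityI subsetI)
  fix C assume C: "C \<in> order_complex (h ` A) s"
  define B where "B = h -` C"
  have "C = h ` B" "B \<subseteq> A"
    using C \<open>inj h\<close> unfolding B_def order_complex_def by (auto dest: injD)
  moreover from this have "B \<in> order_complex A r"
    using C assms unfolding order_complex_def Chains_def by (auto intro: finite_subset) blast
  ultimately show "C \<in> (`) h ` order_complex A r" by blast
next
  fix C assume "C \<in> (`) h ` order_complex A r"
  then obtain B where B: "C = h ` B" "B \<subseteq> A" "finite B" "B \<in> Chains r"
    unfolding order_complex_def by blast
  have "(h a, h b) \<in> s \<or> (h b, h a) \<in> s" if "a \<in> B" "b \<in> B" for a b
    using that B assms(3) unfolding Chains_def by blast
  then show "C \<in> order_complex (h ` A) s"
    using B unfolding order_complex_def Chains_def by auto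
qed

text \<open>The mapping cylinder of \<open>f\<close> as a poset, with the target below the source:
  the target elements below \<open>Inl x\<close> are those up to \<open>f x\<close>, and the source
  elements above \<open>Inr y\<close> form the fibre of \<open>y\<close>.\<close>

definition cylinder_rel :: "'a rel \<Rightarrow> 'b rel \<Rightarrow> ('a \<Rightarrow> 'b) \<Rightarrow> ('a + 'b) rel" where
  "cylinder_rel RX RY f =
     {(u, v). case (u, v) of (Inl x, Inl x') \<Rightarrow> (x, x') \<in> RX | (Inr y, Inr y') \<Rightarrow> (y, y') \<in> RY
        | (Inr y, Inl x) \<Rightarrow> (y, f x) \<in> RY | (Inl x, Inr y) \<Rightarrow> False}"

lemma cylinder_rel_simps [simp]:
  "(Inl x, Inl x') \<in> cylinder_rel RX RY f \<longleftrightarrow> (x, x') \<in> RX"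
  "(Inr y, Inr y') \<in> cylinder_rel RX RY f \<longleftrightarrow> (y, y') \<in> RY"
  "(Inr y, Inl x) \<in> cylinder_rel RX RY f \<longleftrightarrow> (y, f x) \<in> RY"
  "(Inl x, Inr y) \<notin> cylinder_rel RX RY f"
  by (simp_all add: cylinder_rel_def)

abbreviation mapping_cylinder ::
    "'a set \<Rightarrow> 'a rel \<Rightarrow> 'b set \<Rightarrow> 'b rel \<Rightarrow> ('a \<Rightarrow> 'b) \<Rightarrow> ('a + 'b) set set" where
  "mapping_cylinder X RX Y RY f \<equiv> order_complex (X <+> Y) (cylinder_rel RX RY f)"

text \<open>If \<open>x\<close> is minimal in the remaining source, everything comparable to it lies
  either above it in the source, hence above \<open>f x\<close> by monotonicity, or below
  \<open>f x\<close> in the target. So \<open>Inr (f x)\<close> is an apex for the link of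
  \<open>Inl x\<close>.\<close>

lemma mapping_cylinder_remove_source:
  assumes fin: "finite X" "finite Y" and Y: "partial_order_on B RY" and YB: "Y \<subseteq> B"
    and f: "f x \<in> Y"
    and mono: "\<And>x'. (x, x') \<in> RX \<Longrightarrow> (f x, f x') \<in> RY"
    and x: "x \<in> X" and minimal: "\<And>z. z \<in> X \<Longrightarrow> (z, x) \<in> RX \<Longrightarrow> z = x"
  shows "geometric_realization (mapping_cylinder X RX Y RY f) homotopy_equivalent_space
         geometric_realization (mapping_cylinder (X - {x}) RX Y RY f)"
proof -
  have simp: "simplicial (mapping_cylinder X RX Y RY f)"
    by (rule simplicial_order_complex) (use fin in auto)
  have refl: "(f x, f x) \<in> RY"
    using partial_order_onD(1)[OF Y] f YB by (auto simp: refl_on_def)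
  have "insert (Inr (f x)) \<tau> \<in> mapping_cylinder X RX Y RY f"
    if \<tau>: "\<tau> \<in> mapping_cylinder X RX Y RY f" and x\<tau>: "{Inl x} \<subseteq> \<tau>" for \<tau>
  proof (rule insert_order_complex[OF \<tau>])
    fix b assume b: "b \<in> \<tau>"
    have x\<tau>': "Inl x \<in> \<tau>" using x\<tau> by blast
    show "(Inr (f x), b) \<in> cylinder_rel RX RY f \<or> (b, Inr (f x)) \<in> cylinder_rel RX RY f"
    proof (cases b)
      case (Inl x')
      then show ?thesis
        using order_complexD[OF \<tau> b x\<tau>'] minimal mono refl by auto
    next
      case (Inr y)
      then show ?thesis
        using order_complexD[OF \<tau> b x\<tau>'] by auto
    qed
  qed (use f refl in auto)
  moreover have "{\<tau> \<in> mapping_cylinder X RX Y RY f. \<not> {Inl x} \<subseteq> \<tau>} =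
      mapping_cylinder (X - {x}) RX Y RY f"
    unfolding order_complex_def by auto
  ultimately show ?thesis
    using homotopy_equivalent_delete_face[OF simp, of "{Inl x}" "Inr (f x)"] by simp
qed

text \<open>If \<open>y\<close> is maximal in the remaining target, its link is the join of the part
  of the target below it with the order complex of its fibre. Elements below \<open>y\<close> are
  comparable to the whole fibre, so only comparisons inside the fibre matter for an apex taken
  there.\<close>

lemma mapping_cylinder_remove_target:
  assumes fin: "finite X" "finite Y" and X: "partial_order_on X RX" and Y: "partial_order_on B RY"
    and y: "y \<in> Y" and maximal: "\<And>z. z \<in> Y \<Longrightarrow> (y, z) \<in> RY \<Longrightarrow> z = y"
    and fibre: "conically_contractible {x \<in> X. (y, f x) \<in> RY} RX"
  shows "geometric_realization (mapping_cylinder X RX Y RY f) homotopy_equivalent_space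
         geometric_realization (mapping_cylinder X RX (Y - {y}) RY f)"
proof -
  define F where "F = {x \<in> X. (y, f x) \<in> RY}"
  note transX = transD[OF partial_order_onD(2)[OF X]] and transY = transD[OF partial_order_onD(2)[OF Y]]
  obtain g w where w: "w \<in> F" "g w = w"
    and g: "\<And>x. x \<in> F \<Longrightarrow> g x \<in> F" "\<And>x. x \<in> F \<Longrightarrow> g (g x) = g x" "\<And>x. x \<in> F \<Longrightarrow> (g x, x) \<in> RX"
      "\<And>x. x \<in> F \<Longrightarrow> (g x, w) \<in> RX \<or> (w, g x) \<in> RX"
      "\<And>x x'. x \<in> F \<Longrightarrow> x' \<in> F \<Longrightarrow> (x, x') \<in> RX \<Longrightarrow> (g x, g x') \<in> RX"
    using fibre unfolding conically_contractible_def F_def[symmetric] by blast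
  \<comment> \<open>First the edges from \<open>y\<close> to the points moved by \<open>g\<close> are deleted, the edge to \<open>x\<close> with apex
    \<open>g x\<close> and minimal \<open>x\<close> first; then the link of \<open>y\<close> is a cone with apex \<open>w\<close>.\<close>
  define N where "N = {x \<in> F. g x \<noteq> x}"
  define K where "K = mapping_cylinder X RX Y RY f"
  define E where "E D = {\<tau> \<in> K. Inr y \<in> \<tau> \<longrightarrow> (\<forall>x\<in>D. Inl x \<notin> \<tau>)}" for D
  have simpE: "simplicial (E D)" for D
    unfolding E_def K_def
    by (rule simplicial_Collect[OF simplicial_order_complex]) (use fin in auto)
  note KD = order_complexD[of _ "X <+> Y" "cylinder_rel RX RY f", folded K_def]
  have in_F: "x \<in> F" if "\<tau> \<in> K" "Inr y \<in> \<tau>" "Inl x \<in> \<tau>" for \<tau> x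
    using KD[OF that(1,3,2)] by (auto simp: F_def)
  have insert_K: "insert (Inl a) \<tau> \<in> K"
    if \<tau>: "\<tau> \<in> K" and y\<tau>: "Inr y \<in> \<tau>" and a: "a \<in> F"
      and comparable: "\<And>x. Inl x \<in> \<tau> \<Longrightarrow> (a, x) \<in> RX \<or> (x, a) \<in> RX" for a \<tau>
    unfolding K_def
  proof (rule insert_order_complex[OF \<tau>[unfolded K_def]])
    fix b assume b: "b \<in> \<tau>"
    show "(Inl a, b) \<in> cylinder_rel RX RY f \<or> (b, Inl a) \<in> cylinder_rel RX RY f"
    proof (cases b)
      case (Inl x)
      then show ?thesis using b comparable by auto
    next
      case (Inr z)
      then have "z \<in> Y" "(z, y) \<in> RY \<or> (y, z) \<in> RY"
        using KD[OF \<tau> b y\<tau>] by auto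
      then show ?thesis using Inr a maximal transY by (auto simp: F_def)
    qed
  qed (use a partial_order_onD(1)[OF X] in \<open>auto simp: F_def refl_on_def\<close>)
  \<comment> \<open>\<open>M\<close> holds the moved points whose edge to \<open>y\<close> is still
    present; the induction shrinks it, and \<open>M = N\<close> gives
    \<open>E {} = K\<close>.\<close>
  have edges: "geometric_realization (E (N - M)) homotopy_equivalent_space geometric_realization (E N)"
    if "M \<subseteq> N" for M
  proof -
    have "finite M" using that fin unfolding N_def F_def by (auto intro: finite_subset)
    from this partial_order_onD(3)[OF X] partial_order_onD(2)[OF X] show ?thesis
    proof (induction M rule: finite_poset_induct)
      case empty
      show ?case by (simp add: homotopy_equivalent_space_refl)
    next
      case (minimal S x)
      then have xN: "x \<in> N" and xF: "x \<in> F" using that by (auto simp: N_def)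
      have "insert (Inl (g x)) \<tau> \<in> E (N - S)"
        if \<tau>: "\<tau> \<in> E (N - S)" and e: "{Inr y, Inl x} \<subseteq> \<tau>" for \<tau>
      proof -
        have \<tau>': "\<tau> \<in> K" using \<tau> unfolding E_def by blast
        have e': "Inr y \<in> \<tau>" "Inl x \<in> \<tau>" using e by auto
        have "(g x, z) \<in> RX \<or> (z, g x) \<in> RX" if z: "Inl z \<in> \<tau>" for z
        proof -
          have zF: "z \<in> F" using in_F \<tau>' e' z by blast
          \<comment> \<open>Above \<open>x\<close> one has \<open>g x \<le> x \<le> z\<close>. Below
            \<open>x\<close>, minimality of \<open>x\<close> means that the edge to \<open>z\<close>
            is already deleted if \<open>g\<close> moves \<open>z\<close>; so
            \<open>z = g z \<le> g x\<close>.\<close>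
          consider "(x, z) \<in> RX" | "(z, x) \<in> RX" "z \<noteq> x"
            using KD(2)[OF \<tau>' z e'(2)] by auto
          then show ?thesis
          proof cases
            case 1
            then show ?thesis using transX g(3)[OF xF] by blast
          next
            case 2
            then have "z \<notin> S" using minimal(3) by blast
            then have "z \<notin> N" using \<tau> e' z unfolding E_def by blast
            then have "g z = z" using zF N_def by blast
            then show ?thesis using g(5)[OF zF xF] 2 by simp
          qed
        qed
        then have "insert (Inl (g x)) \<tau> \<in> K" using insert_K \<tau>' e' g(1)[OF xF] by blast
        \<comment> \<open>By idempotence the apex is a fixed point, so no deleted edge leads to
          it.\<close>
        moreover have "g x \<notin> N" using g(2)[OF xF] by (auto simp: N_def)
        ultimately show ?thesis using \<tau> unfolding E_def by auto
      qed
      moreover have "Inl (g x) \<notin> {Inr y, Inl x}" using xN by (auto simp: N_def)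
      moreover have "{\<tau> \<in> E (N - S). \<not> {Inr y, Inl x} \<subseteq> \<tau>} = E (N - (S - {x}))"
        using xN minimal(2) unfolding E_def by auto
      ultimately have "geometric_realization (E (N - S)) homotopy_equivalent_space
          geometric_realization (E (N - (S - {x})))"
        using homotopy_equivalent_delete_face[OF simpE, of "{Inr y, Inl x}" "Inl (g x)" "N - S"] by simp
      then show ?case using minimal(4) homotopy_eqv_trans by blast
    qed
  qed
  have "insert (Inl w) \<tau> \<in> E N" if \<tau>: "\<tau> \<in> E N" and y: "{Inr y} \<subseteq> \<tau>" for \<tau>
  proof -
    have \<tau>': "\<tau> \<in> K" using \<tau> unfolding E_def by blast
    have "(w, z) \<in> RX \<or> (z, w) \<in> RX" if z: "Inl z \<in> \<tau>" for z
    proof -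
      have zF: "z \<in> F" using in_F \<tau>' y z by blast
      have "z \<notin> N" using \<tau> y z unfolding E_def by blast
      then have "g z = z" using zF by (simp add: N_def)
      then show ?thesis using g(4)[OF zF] by auto
    qed
    then have "insert (Inl w) \<tau> \<in> K" using insert_K \<tau>' y w(1) by blast
    moreover have "w \<notin> N" using w by (simp add: N_def)
    ultimately show ?thesis using \<tau> unfolding E_def by auto
  qed
  moreover have "{\<tau> \<in> E N. \<not> {Inr y} \<subseteq> \<tau>} = mapping_cylinder X RX (Y - {y}) RY f"
    unfolding E_def K_def order_complex_def by auto
  ultimately have "geometric_realization (E N) homotopy_equivalent_space
      geometric_realization (mapping_cylinder X RX (Y - {y}) RY f)"
    using homotopy_equivalent_delete_face[OF simpE, of "{Inr y}" "Inl w" N] by simp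
  moreover have "geometric_realization K homotopy_equivalent_space geometric_realization (E N)"
    using edges[of N] by (simp add: E_def)
  ultimately show ?thesis
    unfolding K_def using homotopy_eqv_trans by blast
qed

text \<open>Both posets are ends of one mapping cylinder. Deleting the source bottom up leaves
  \<open>Y\<close>, deleting the target top down leaves \<open>X\<close>, and neither changes the
  homotopy type.\<close>

lemma quillen_fibre:
  assumes fin: "finite X" "finite Y" and X: "partial_order_on X RX" and Y: "partial_order_on Y RY"
    and f: "\<And>x. x \<in> X \<Longrightarrow> f x \<in> Y"
    and mono: "\<And>x x'. (x, x') \<in> RX \<Longrightarrow> (f x, f x') \<in> RY"
    and fibre: "\<And>y. y \<in> Y \<Longrightarrow> conically_contractible {x \<in> X. (y, f x) \<in> RY} RX"
  shows "geometric_realization (order_complex X RX) homotopy_equivalent_space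
         geometric_realization (order_complex Y RY)"
proof -
  let ?G = "\<lambda>X Y. geometric_realization (mapping_cylinder X RX Y RY f)"
  from fin(1) partial_order_onD(3)[OF X] partial_order_onD(2)[OF X]
  have 1: "?G X Y homotopy_equivalent_space ?G {} Y"
  proof (induction X rule: finite_poset_induct)
    case empty
    show ?case by (simp add: homotopy_equivalent_space_refl)
  next
    case (minimal S x)
    have "?G S Y homotopy_equivalent_space ?G (S - {x}) Y"
      using minimal(1-3) f mono fin finite_subset[OF minimal(1)]
      by (intro mapping_cylinder_remove_source[OF _ _ Y]) auto
    then show ?case using minimal(4) homotopy_eqv_trans by blast
  qed
  have "antisym (RY\<inverse>)" "trans (RY\<inverse>)"
    using partial_order_onD[OF Y] by auto
  with fin(2) have 2: "?G X Y homotopy_equivalent_space ?G X {}"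
  proof (induction Y rule: finite_poset_induct)
    case empty
    show ?case by (simp add: homotopy_equivalent_space_refl)
  next
    case (minimal S y)
    have "?G X S homotopy_equivalent_space ?G X (S - {y})"
      using minimal(1-3) fibre fin finite_subset[OF minimal(1)]
      by (intro mapping_cylinder_remove_target[OF _ _ X Y]) auto
    then show ?case using minimal(4) homotopy_eqv_trans by blast
  qed
  have 3: "?G {} Y homotopy_equivalent_space geometric_realization (order_complex Y RY)"
    using order_complex_image[OF fin(2), of Inr "cylinder_rel RX RY f" RY]
      homotopy_equivalent_rename[of Inr "order_complex Y RY"]
    by (simp add: Plus_def inj_on_def)
  have 4: "?G X {} homotopy_equivalent_space geometric_realization (order_complex X RX)"
    using order_complex_image[OF fin(1), of Inl "cylinder_rel RX RY f" RX]
      homotopy_equivalent_rename[of Inl "order_complex X RX"]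
    by (simp add: Plus_def inj_on_def)
  note sym = homotopy_equivalent_space_sym[THEN iffD1]
  show ?thesis
    by (rule homotopy_eqv_trans[OF sym[OF 4] homotopy_eqv_trans[OF sym[OF 2] homotopy_eqv_trans[OF 1 3]]])
qed

subsection \<open>Monotone families with signed coordinatewise order\<close>

definition monotone_families :: "'a set \<Rightarrow> 'a rel \<Rightarrow> nat set \<Rightarrow> (nat \<Rightarrow> 'a) set" where
  "monotone_families P R T = {p \<in> T \<rightarrow>\<^sub>E P. \<forall>s\<in>T. \<forall>t\<in>T. s \<le> t \<longrightarrow> (p s, p t) \<in> R}"

definition signed_rel :: "'a set \<Rightarrow> 'a rel \<Rightarrow> nat set \<Rightarrow> (nat \<Rightarrow> bool) \<Rightarrow> (nat \<Rightarrow> 'a) rel" where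
  "signed_rel P R T \<epsilon> =
     {(p, q). p \<in> monotone_families P R T \<and> q \<in> monotone_families P R T \<and>
        (\<forall>t\<in>T. if \<epsilon> t then (p t, q t) \<in> R else (q t, p t) \<in> R)}"

lemma multichains_eq: "multichains P R r = monotone_families P R {1..r}"
  unfolding multichains_def monotone_families_def by simp

lemma finite_monotone_families:
  assumes "finite P" "finite T"
  shows "finite (monotone_families P R T)"
proof (rule finite_subset)
  show "monotone_families P R T \<subseteq> T \<rightarrow>\<^sub>E P" unfolding monotone_families_def by blast
qed (simp add: assms finite_PiE)

lemma partial_order_on_signed_rel:
  assumes R: "partial_order_on P R"
  shows "partial_order_on (monotone_families P R T) (signed_rel P R T \<epsilon>)"
  unfolding partial_order_on_def preorder_on_def
proof (intro conjI)
  note refl = partial_order_onD(1)[OF R, unfolded refl_on_def] and trans = transD[OF partial_order_onD(2)[OF R]]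
    and antisym = antisymD[OF partial_order_onD(3)[OF R]]
  show "signed_rel P R T \<epsilon> \<subseteq> monotone_families P R T \<times> monotone_families P R T"
    unfolding signed_rel_def by blast
  show "refl_on (monotone_families P R T) (signed_rel P R T \<epsilon>)"
    using refl unfolding refl_on_def signed_rel_def monotone_families_def by auto
  show "trans (signed_rel P R T \<epsilon>)"
  proof (rule transI)
    fix p q u assume "(p, q) \<in> signed_rel P R T \<epsilon>" "(q, u) \<in> signed_rel P R T \<epsilon>"
    then show "(p, u) \<in> signed_rel P R T \<epsilon>"
      unfolding signed_rel_def by (auto split: if_splits intro: trans)
  qed
  show "antisym (signed_rel P R T \<epsilon>)"
  proof (rule antisymI)
    fix p q assume *: "(p, q) \<in> signed_rel P R T \<epsilon>" "(q, p) \<in> signed_rel P R T \<epsilon>"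
    then have "p t = q t" if "t \<in> T" for t
      using that antisym unfolding signed_rel_def by (auto split: if_splits)
    moreover have "p \<in> extensional T" "q \<in> extensional T"
      using * unfolding signed_rel_def monotone_families_def by (auto simp: PiE_def)
    ultimately show "p = q" by (auto intro: extensionalityI)
  qed
qed

section \<open>Order reversal and forgetting coordinates\<close>

lemma order_complex_converse: "order_complex A (r\<inverse>) = order_complex A r"
  unfolding order_complex_def Chains_def by auto

text \<open>Chains do not see the direction of an order. Hence one chosen sign can be assumed
  positive.\<close>

lemma order_complex_signed_rel_flip:
  "order_complex A (signed_rel P R T (\<lambda>t. \<not> \<epsilon> t)) = order_complex A (signed_rel P R T \<epsilon>)"
proof -
  have "signed_rel P R T (\<lambda>t. \<not> \<epsilon> t) = (signed_rel P R T \<epsilon>)\<inverse>"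
    unfolding signed_rel_def by (auto split: if_splits)
  then show ?thesis by (simp add: order_complex_converse)
qed

text \<open>For a positive sign, the fibre of evaluation at \<open>b\<close> over \<open>y\<close>
  has the family with entry \<open>y\<close> as least element; the other sign follows by
  flipping.\<close>

lemma signed_rel_singleton:
  fixes P :: "'a set"
  assumes P: "finite P" "partial_order_on P R"
  shows "geometric_realization (order_complex (monotone_families P R {b}) (signed_rel P R {b} \<epsilon>))
         homotopy_equivalent_space geometric_realization (order_complex P R)"
proof -
  note refl = partial_order_onD(1)[OF P(2), unfolded refl_on_def, rule_format]
  have pos: "geometric_realization (order_complex (monotone_families P R {b}) (signed_rel P R {b} \<epsilon>))
         homotopy_equivalent_space geometric_realization (order_complex P R)" if "\<epsilon> b" for \<epsilon>
  proof (rule quillen_fibre[of _ _ _ _ "\<lambda>p. p b"])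
    show "finite (monotone_families P R {b})" using P(1) by (simp add: finite_monotone_families)
    show "partial_order_on (monotone_families P R {b}) (signed_rel P R {b} \<epsilon>)"
      using partial_order_on_signed_rel P(2) .
    show "p b \<in> P" if "p \<in> monotone_families P R {b}" for p
      using that unfolding monotone_families_def by auto
    show "(p b, q b) \<in> R" if "(p, q) \<in> signed_rel P R {b} \<epsilon>" for p q
      using that \<open>\<epsilon> b\<close> unfolding signed_rel_def by auto
    show "conically_contractible {p \<in> monotone_families P R {b}. (y, p b) \<in> R} (signed_rel P R {b} \<epsilon>)"
      if y: "y \<in> P" for y
    proof (rule conically_contractible_least)
      have "(\<lambda>s\<in>{b}. y) \<in> monotone_families P R {b}"
        using y refl unfolding monotone_families_def by auto
      then show mem: "(\<lambda>s\<in>{b}. y) \<in> {p \<in> monotone_families P R {b}. (y, p b) \<in> R}"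
        using y refl by simp
      show "((\<lambda>s\<in>{b}. y), p) \<in> signed_rel P R {b} \<epsilon>"
        if "p \<in> {p \<in> monotone_families P R {b}. (y, p b) \<in> R}" for p
        using that mem \<open>\<epsilon> b\<close> unfolding signed_rel_def by simp
    qed
  qed (use P in auto)
  show ?thesis
  proof (cases "\<epsilon> b")
    case False
    then show ?thesis
      using pos[of "\<lambda>t. \<not> \<epsilon> t"] unfolding order_complex_signed_rel_flip by simp
  qed (rule pos)
qed

text \<open>Let the sign at \<open>l\<close>, the largest index of \<open>T\<close>, be positive, by
  a flip if needed. Over \<open>w\<close>, each \<open>p\<close> can be moved down in the signed
  order to \<open>w\<close> on \<open>T\<close> while keeping \<open>p m\<close>, since
  \<open>w l \<le> p l \<le> p m\<close>. The resulting points differ only at \<open>m\<close>,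
  where \<open>w l\<close> is comparable to every value that occurs, whatever the sign of
  \<open>m\<close>.\<close>

lemma signed_rel_drop_last:
  fixes P :: "'a set"
  assumes P: "finite P" "partial_order_on P R"
    and T: "finite T" "T \<noteq> {}" "\<forall>t\<in>T. t < m"
  shows "geometric_realization (order_complex (monotone_families P R (insert m T)) (signed_rel P R (insert m T) \<epsilon>))
         homotopy_equivalent_space
         geometric_realization (order_complex (monotone_families P R T) (signed_rel P R T \<epsilon>))"
proof -
  note refl = partial_order_onD(1)[OF P(2), unfolded refl_on_def, rule_format]
  note trans = transD[OF partial_order_onD(2)[OF P(2)]]
  define l where "l = Max T"
  have l: "l \<in> T" "\<And>t. t \<in> T \<Longrightarrow> t \<le> l" using T l_def by auto
  have m: "m \<notin> T" using T(3) by blast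
  let ?X = "monotone_families P R (insert m T)" and ?Y = "monotone_families P R T"
  have pos: "geometric_realization (order_complex ?X (signed_rel P R (insert m T) \<epsilon>))
         homotopy_equivalent_space geometric_realization (order_complex ?Y (signed_rel P R T \<epsilon>))"
    if "\<epsilon> l" for \<epsilon>
  proof (rule quillen_fibre[of _ _ _ _ "\<lambda>p. restrict p T"])
    let ?S = "signed_rel P R (insert m T) \<epsilon>"
    show "finite ?X" "finite ?Y" using P(1) T(1) by (simp_all add: finite_monotone_families)
    show "partial_order_on ?X ?S" "partial_order_on ?Y (signed_rel P R T \<epsilon>)"
      using partial_order_on_signed_rel P(2) by blast+
    show restr: "restrict p T \<in> ?Y" if "p \<in> ?X" for p
      using that unfolding monotone_families_def by auto
    show "(restrict p T, restrict q T) \<in> signed_rel P R T \<epsilon>" if "(p, q) \<in> ?S" for p q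
      using that restr unfolding signed_rel_def by auto
    show "conically_contractible {p \<in> ?X. (w, restrict p T) \<in> signed_rel P R T \<epsilon>} ?S"
      if w: "w \<in> ?Y" for w
    proof -
      let ?F = "{p \<in> ?X. (w, restrict p T) \<in> signed_rel P R T \<epsilon>}"
      have w': "w \<in> T \<rightarrow>\<^sub>E P" "\<And>s t. s \<in> T \<Longrightarrow> t \<in> T \<Longrightarrow> s \<le> t \<Longrightarrow> (w s, w t) \<in> R"
        using w unfolding monotone_families_def by auto
      have upd_F: "w(m := a) \<in> ?F" if a: "a \<in> P" "(w l, a) \<in> R" for a
      proof -
        have "(w s, a) \<in> R" if "s \<in> T" for s
          using trans w'(2)[OF that l(1) l(2)[OF that]] a by blast
        then have "w(m := a) \<in> ?X"
          using w' a T(3) m refl unfolding monotone_families_def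
          by (auto simp: PiE_def extensional_def Pi_def)
        moreover have "restrict (w(m := a)) T = w"
          using w'(1) m by (auto simp: fun_eq_iff PiE_def extensional_def)
        ultimately show ?thesis
          using w w'(2) unfolding signed_rel_def by auto
      qed
      have F: "p \<in> ?X" "p m \<in> P" "(w l, p m) \<in> R"
        "\<And>t. t \<in> T \<Longrightarrow> if \<epsilon> t then (w t, p t) \<in> R else (p t, w t) \<in> R" if "p \<in> ?F" for p
      proof -
        show "p \<in> ?X" using that by blast
        then show "p m \<in> P" unfolding monotone_families_def by auto
        show *: "if \<epsilon> t then (w t, p t) \<in> R else (p t, w t) \<in> R" if "t \<in> T" for t
          using \<open>p \<in> ?F\<close> that unfolding signed_rel_def by (auto split: if_splits)
        have "(p l, p m) \<in> R"
          using \<open>p \<in> ?X\<close> l(1) T(3) unfolding monotone_families_def by auto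
        then show "(w l, p m) \<in> R" using *[OF l(1)] \<open>\<epsilon> l\<close> trans by auto
      qed
      have wl: "w l \<in> P" using w'(1) l(1) by auto
      have upd_rel: "(w(m := a), w(m := b)) \<in> ?S"
        if "w(m := a) \<in> ?F" "w(m := b) \<in> ?F" "if \<epsilon> m then (a, b) \<in> R else (b, a) \<in> R" for a b
        using that w'(2) m unfolding signed_rel_def by auto
      show ?thesis
        unfolding conically_contractible_def
      proof (intro exI[of _ "\<lambda>p. w(m := p m)"] exI[of _ "w(m := w l)"] conjI ballI impI)
        show centre: "w(m := w l) \<in> ?F" using upd_F wl refl by blast
        fix p assume p: "p \<in> ?F"
        show gp: "w(m := p m) \<in> ?F" using upd_F F[OF p] by blast
        show "(w(m := p m), p) \<in> ?S"
          using gp F[OF p] refl m unfolding signed_rel_def by auto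
        show "(w(m := p m), w(m := w l)) \<in> ?S \<or> (w(m := w l), w(m := p m)) \<in> ?S"
          using upd_rel gp centre F(3)[OF p] by (cases "\<epsilon> m") auto
        fix q assume q: "q \<in> ?F" "(p, q) \<in> ?S"
        have "w(m := q m) \<in> ?F" using upd_F F[OF q(1)] by blast
        moreover have "if \<epsilon> m then (p m, q m) \<in> R else (q m, p m) \<in> R"
          using q(2) unfolding signed_rel_def by auto
        ultimately show "(w(m := p m), w(m := q m)) \<in> ?S"
          using upd_rel gp by blast
      qed simp_all
    qed
  qed
  show ?thesis
  proof (cases "\<epsilon> l")
    case False
    then show ?thesis
      using pos[of "\<lambda>t. \<not> \<epsilon> t"] unfolding order_complex_signed_rel_flip by simp
  qed (rule pos)
qed

lemma signed_rel_homotopy_equivalent: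
  fixes P :: "'a set"
  assumes P: "finite P" "partial_order_on P R" and "finite T" "T \<noteq> {}"
  shows "geometric_realization (order_complex (monotone_families P R T) (signed_rel P R T \<epsilon>))
         homotopy_equivalent_space geometric_realization (order_complex P R)"
  using assms(3,4)
proof (induction T rule: finite_linorder_max_induct)
  case (insert m T)
  show ?case
  proof (cases "T = {}")
    case True
    then show ?thesis using signed_rel_singleton[OF P] by simp
  next
    case False
    then show ?thesis
      using homotopy_eqv_trans[OF signed_rel_drop_last[OF P insert(1) False insert(2)] insert(3)[OF False]] by simp
  qed
qed simp

subsection \<open>Multichains\<close>

text \<open>By \<open>stable\<close>, \<open>T\<close> consists of the values
  \<open>b \<ge> 1\<close> of \<open>j\<close> on \<open>{1..r}\<close>, where the sign is negative,
  and the successors \<open>b + 1 \<le> r\<close>, where it is positive. Since \<open>q\<close> is a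
  multichain, \<open>multichain_prec\<close> only says that \<open>p t\<close> lies between
  \<open>q (j t)\<close> and \<open>q (j t + 1)\<close>, as far as these exist, so the coordinates
  of \<open>q\<close> in \<open>T\<close> decide it.\<close>

lemma multichain_rel_reduce:
  fixes P :: "'a set"
  assumes P: "finite P" "partial_order_on P R"
    and Q: "partial_order_on (multichains P R r) (multichain_rel P R r \<iota>)"
    and j: "\<And>t. t \<in> {1..r} \<Longrightarrow> \<iota> t - t = j t" "\<And>t. t \<in> {1..r} \<Longrightarrow> j t \<le> r"
    and mono: "\<And>s t. s \<in> {1..r} \<Longrightarrow> t \<in> {1..r} \<Longrightarrow> s \<le> t \<Longrightarrow> j s \<le> j t"
    and stable: "\<And>t. t \<in> {1..r} \<Longrightarrow> 1 \<le> j t \<Longrightarrow> j (j t) = j t"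
      "\<And>t. t \<in> {1..r} \<Longrightarrow> j t < r \<Longrightarrow> j (Suc (j t)) = j t"
    and T_def: "T = {t \<in> {1..r}. j t = t \<or> Suc (j t) = t}"
  shows "geometric_realization (order_complex (multichains P R r) (multichain_rel P R r \<iota>))
         homotopy_equivalent_space
         geometric_realization (order_complex (monotone_families P R T) (signed_rel P R T (\<lambda>t. j t < t)))"
proof (rule quillen_fibre[of _ _ _ _ "\<lambda>p. restrict p T"])
  let ?S = "signed_rel P R T (\<lambda>t. j t < t)" and ?X = "multichains P R r"
  note trans = transD[OF partial_order_onD(2)[OF P(2)]]
  have T: "T \<subseteq> {1..r}" "finite T" unfolding T_def by auto
  show "finite ?X" "finite (monotone_families P R T)"
    using P(1) T(2) by (simp_all add: multichains_eq finite_monotone_families)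
  show S: "partial_order_on (monotone_families P R T) ?S"
    using partial_order_on_signed_rel P(2) .
  show restr: "restrict p T \<in> monotone_families P R T" if "p \<in> ?X" for p
    using that T unfolding multichains_def monotone_families_def by auto
  show "(restrict p T, restrict q T) \<in> ?S" if pq: "(p, q) \<in> multichain_rel P R r \<iota>" for p q
  proof (cases "p = q")
    case True
    then show ?thesis
      using S restr pq unfolding partial_order_on_def preorder_on_def refl_on_def multichain_rel_def by auto
  next
    case False
    then have "multichain_prec R r \<iota> p q" "p \<in> ?X" "q \<in> ?X" using pq unfolding multichain_rel_def by auto
    \<comment> \<open>The case \<open>s = t\<close> of \<open>multichain_prec\<close>; its two
      branches are the two signs.\<close>
    moreover have "if j t < t then (p t, q t) \<in> R else (q t, p t) \<in> R" if "t \<in> T" for t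
      using calculation(1) that j(1)[of t] T(1) unfolding multichain_prec_def T_def by auto
    ultimately show ?thesis using restr unfolding signed_rel_def by auto
  qed
  show "conically_contractible {p \<in> ?X. (w, restrict p T) \<in> ?S} (multichain_rel P R r \<iota>)"
    if w: "w \<in> monotone_families P R T" for w
  proof -
    \<comment> \<open>For \<open>e t\<close>, any monotone choice between \<open>w (j t)\<close> and
      \<open>w (j t + 1)\<close> would precede the fibre. This one fixes every index in
      \<open>T\<close>, so that \<open>e\<close> extends \<open>w\<close>, and never needs the index
      0 or \<open>r + 1\<close>.\<close>
    define k where "k t = (if t \<le> j t then j t else Suc (j t))" for t
    have jT: "j t \<in> T" if "t \<in> {1..r}" "1 \<le> j t" for t
      using stable(1)[OF that] j(2)[OF that(1)] that unfolding T_def by auto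
    have sjT: "Suc (j t) \<in> T" if "t \<in> {1..r}" "j t < r" for t
      using stable(2)[OF that] that unfolding T_def by auto
    have kT: "k t \<in> T" if "t \<in> {1..r}" for t
      using jT[OF that] sjT[OF that] that unfolding k_def by auto
    have k_mono: "k s \<le> k t" if "s \<in> {1..r}" "t \<in> {1..r}" "s \<le> t" for s t
      using mono[OF that] that unfolding k_def by auto
    have w': "w \<in> T \<rightarrow>\<^sub>E P" "\<And>s t. s \<in> T \<Longrightarrow> t \<in> T \<Longrightarrow> s \<le> t \<Longrightarrow> (w s, w t) \<in> R"
      using w unfolding monotone_families_def by auto
    define e where "e = (\<lambda>t\<in>{1..r}. w (k t))"
    have eX: "e \<in> ?X"
      using w' kT k_mono unfolding multichains_def e_def by auto
    have "restrict e T = w"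
    proof
      fix t show "restrict e T t = w t"
        using w'(1) T(1) by (cases "t \<in> T") (auto simp: e_def k_def T_def PiE_def extensional_def)
    qed
    moreover have "(w, w) \<in> ?S"
      using S w unfolding partial_order_on_def preorder_on_def refl_on_def by blast
    ultimately have eF: "e \<in> {p \<in> ?X. (w, restrict p T) \<in> ?S}" using eX by simp
    show ?thesis
    proof (rule conically_contractible_least[OF eF])
      fix p assume "p \<in> {p \<in> ?X. (w, restrict p T) \<in> ?S}"
      then have pX: "p \<in> ?X" and wp: "\<And>t. t \<in> T \<Longrightarrow> if j t < t then (w t, p t) \<in> R else (p t, w t) \<in> R"
        unfolding signed_rel_def by (auto split: if_splits)
      have p_mono: "(p s, p t) \<in> R" if "s \<in> {1..r}" "t \<in> {1..r}" "s \<le> t" for s t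
        using pX that unfolding multichains_def by auto
      have "multichain_prec R r \<iota> e p"
        unfolding multichain_prec_def
      proof (intro ballI conjI impI)
        fix t s assume t: "t \<in> {1..r}" and s: "s \<in> {1..r}"
        {
          \<comment> \<open>Here \<open>p s \<le> p (j t) \<le> w (j t) \<le> w (k t)\<close>, the
            middle step by the negative sign at \<open>j t\<close>; the other case is dual, with the
            positive sign at \<open>j t + 1\<close>.\<close>
          assume "s \<le> \<iota> t - t"
          then have sj: "s \<le> j t" "1 \<le> j t" using j(1)[OF t] s by auto
          note J = jT[OF t sj(2)]
          have "(p s, p (j t)) \<in> R" using p_mono s sj j(2)[OF t] by auto
          moreover have "(p (j t), w (j t)) \<in> R"
            using wp[OF J] stable(1)[OF t sj(2)] by simp
          moreover have "(w (j t), w (k t)) \<in> R"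
            using w'(2)[OF J kT[OF t]] by (auto simp: k_def)
          ultimately have "(p s, w (k t)) \<in> R" using trans by blast
          then show "(p s, e t) \<in> R" using t by (simp add: e_def)
        next
          assume "s > \<iota> t - t"
          then have sj: "Suc (j t) \<le> s" "j t < r" using j(1)[OF t] s by auto
          note J = sjT[OF t sj(2)]
          have "(p (Suc (j t)), p s) \<in> R" using p_mono s sj by auto
          moreover have "(w (Suc (j t)), p (Suc (j t))) \<in> R"
            using wp[OF J] stable(2)[OF t sj(2)] by simp
          moreover have "(w (k t), w (Suc (j t))) \<in> R"
            using w'(2)[OF kT[OF t] J] by (auto simp: k_def)
          ultimately have "(w (k t), p s) \<in> R" using trans by blast
          then show "(e t, p s) \<in> R" using t by (simp add: e_def)
        }
      qed
      then show "(e, p) \<in> multichain_rel P R r \<iota>"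
        using eX pX unfolding multichain_rel_def by auto
    qed
  qed
qed (use Q in auto)

text \<open>On multichains with values in \<open>{x, y}\<close> the relation becomes one between
  numbers in \<open>{0..r}\<close>. For \<open>b = j t\<close> both \<open>t - 1\<close> and
  \<open>t\<close> are related to \<open>b\<close>, and transitivity squeezes \<open>J b\<close> and
  \<open>J (b + 1)\<close> to \<open>b\<close>.\<close>

lemma multichain_rel_partial_order_stable:
  fixes P :: "'a set"
  assumes P: "partial_order_on P R"
    and Q: "partial_order_on (multichains P R r) (multichain_rel P R r \<iota>)"
    and j: "\<And>t. t \<in> {1..r} \<Longrightarrow> \<iota> t - t = j t" "\<And>t. t \<in> {1..r} \<Longrightarrow> j t \<le> r"
    and mono: "\<And>s t. s \<in> {1..r} \<Longrightarrow> t \<in> {1..r} \<Longrightarrow> s \<le> t \<Longrightarrow> j s \<le> j t"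
    and xy: "(x, y) \<in> R" "x \<noteq> y"
    and t: "t \<in> {1..r}"
  shows "1 \<le> j t \<Longrightarrow> j (j t) = j t" and "j t < r \<Longrightarrow> j (Suc (j t)) = j t"
proof -
  note refl = partial_order_onD(1)[OF P, unfolded refl_on_def, rule_format]
  note trans = transD[OF partial_order_onD(2)[OF Q]]
  note antisym = antisymD[OF partial_order_onD(3)[OF Q]]
  have in_P: "x \<in> P" "y \<in> P" using xy partial_order_onD(4)[OF P] by auto
  have yx: "(y, x) \<notin> R" using xy antisymD[OF partial_order_onD(3)[OF P]] by blast
  have loops: "(x, x) \<in> R" "(y, y) \<in> R" using refl in_P by auto
  \<comment> \<open>For the chain \<open>x < y\<close> the multichain \<open>c a\<close> starts with \<open>a\<close> copies of \<open>x\<close>, and \<open>c a\<close> precedes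
    \<open>c b\<close> iff \<open>J a \<le> b \<le> J (a + 1)\<close>, where \<open>J\<close> extends \<open>j\<close> by \<open>0\<close> and \<open>r\<close>.\<close>
  define c where "c a = (\<lambda>s\<in>{1..r}. if s \<le> a then x else y)" for a
  define J where "J a = (if a = 0 then 0 else if a > r then r else j a)" for a
  have cX: "c a \<in> multichains P R r" for a
    using in_P loops xy unfolding multichains_def c_def by auto
  have J_le: "J a \<le> r" for a using j(2)[of a] unfolding J_def by auto
  have J_mono: "J a \<le> J b" if "a \<le> b" for a b
    using mono[of a b] j(2)[of a] that unfolding J_def by auto
  have c_inj: "a = b" if "c a = c b" "a \<le> r" "b \<le> r" for a b
  proof (rule ccontr)
    assume "a \<noteq> b"
    then consider "a < b" | "b < a" by linarith
    then show False
    proof cases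
      case 1
      then show ?thesis using fun_cong[OF that(1), of b] that xy by (auto simp: c_def)
    next
      case 2
      then show ?thesis using fun_cong[OF that(1), of a] that xy by (auto simp: c_def)
    qed
  qed
  have prec_iff: "multichain_prec R r \<iota> (c a) (c b) \<longleftrightarrow> J a \<le> b \<and> b \<le> J (Suc a)"
    if ab: "a \<le> r" "b \<le> r" for a b
  proof
    assume L: "multichain_prec R r \<iota> (c a) (c b)"
    \<comment> \<open>A violated bound would force \<open>y \<le> x\<close>: position
      \<open>b + 1\<close> of \<open>c b\<close> is \<open>y\<close> and position \<open>a\<close>
      of \<open>c a\<close> is \<open>x\<close>. The second bound uses the positions
      \<open>a + 1\<close> and \<open>b\<close> likewise.\<close>
    have "J a \<le> b"
    proof (rule ccontr)
      assume n: "\<not> J a \<le> b"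
      then have a: "a \<in> {1..r}" "b < j a" using ab by (auto simp: J_def split: if_splits)
      then have "(c b (Suc b), c a a) \<in> R"
        using L j[OF a(1)] ab unfolding multichain_prec_def by auto
      then show False using a j(2)[OF a(1)] yx by (auto simp: c_def split: if_splits)
    qed
    moreover have "b \<le> J (Suc a)"
    proof (rule ccontr)
      assume n: "\<not> b \<le> J (Suc a)"
      then have a: "Suc a \<in> {1..r}" "j (Suc a) < b" using ab by (auto simp: J_def split: if_splits)
      then have "(c a (Suc a), c b b) \<in> R"
        using L j[OF a(1)] ab unfolding multichain_prec_def by auto
      then show False using a ab yx by (auto simp: c_def split: if_splits)
    qed
    ultimately show "J a \<le> b \<and> b \<le> J (Suc a)" by blast
  next
    assume ab': "J a \<le> b \<and> b \<le> J (Suc a)"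
    show "multichain_prec R r \<iota> (c a) (c b)"
      unfolding multichain_prec_def
    proof (intro ballI conjI impI)
      fix u s assume u: "u \<in> {1..r}" and s: "s \<in> {1..r}"
      have Ju: "J u = j u" using u by (simp add: J_def)
      {
        assume "s \<le> \<iota> u - u"
        then have "s \<le> J u" using j(1)[OF u] Ju by simp
        moreover have "J u \<le> J a" if "u \<le> a" using that by (rule J_mono)
        \<comment> \<open>The relation can only fail for an entry \<open>y\<close> of
          \<open>c b\<close> and an entry \<open>x\<close> of \<open>c a\<close>, that is for
          \<open>u \<le> a\<close> and \<open>b < s\<close>.\<close>
        ultimately have "\<not> (u \<le> a \<and> b < s)" using ab' by linarith
        then show "(c b s, c a u) \<in> R" using u s loops xy by (auto simp: c_def)
      next
        assume "s > \<iota> u - u"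
        then have "s > J u" using j(1)[OF u] Ju by simp
        moreover have "J (Suc a) \<le> J u" if "a < u" using that by (intro J_mono) simp
        ultimately have "\<not> (a < u \<and> s \<le> b)" using ab' by linarith
        then show "(c a u, c b s) \<in> R" using u s loops xy by (auto simp: c_def)
      }
    qed
  qed
  have rel_iff: "(c a, c b) \<in> multichain_rel P R r \<iota> \<longleftrightarrow> a = b \<or> J a \<le> b \<and> b \<le> J (Suc a)"
    if "a \<le> r" "b \<le> r" for a b
    using prec_iff[OF that] c_inj[OF _ that] cX unfolding multichain_rel_def by auto
  define b where "b = J t"
  have b: "b = j t" "b \<le> r" using t j(2) by (auto simp: b_def J_def)
  obtain a where a: "t = Suc a" "a \<le> r" using t by (cases t) auto
  have tr: "t \<le> r" using t by simp
  have t_b: "(c t, c b) \<in> multichain_rel P R r \<iota>"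
    using rel_iff[OF tr b(2)] J_mono[of t "Suc t"] by (simp add: b_def)
  have a_b: "(c a, c b) \<in> multichain_rel P R r \<iota>"
    using rel_iff[OF a(2) b(2)] J_mono[of a t] a by (simp add: b_def)
  have b_lo: "(c b, c (J b)) \<in> multichain_rel P R r \<iota>"
    using rel_iff[OF b(2) J_le] J_mono[of b "Suc b"] by simp
  have b_hi: "(c b, c (J (Suc b))) \<in> multichain_rel P R r \<iota>"
    using rel_iff[OF b(2) J_le] J_mono[of b "Suc b"] by simp
  have inj_b: "d = b" if "d \<le> r" "(c d, c b) \<in> multichain_rel P R r \<iota>"
      "(c b, c d) \<in> multichain_rel P R r \<iota>" for d
    using antisym[OF that(2,3)] c_inj that b by blast
  \<comment> \<open>Transitivity via \<open>b\<close> relates \<open>a\<close> to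
    \<open>J b\<close>, so \<open>J b \<le> J (a + 1) = b\<close>; if instead
    \<open>a = J b\<close>, antisymmetry gives \<open>a = b\<close>. The next two bounds come in the
    same way.\<close>
  have "J b \<le> b"
    using rel_iff[OF a(2) J_le] trans[OF a_b b_lo] inj_b[OF a(2) a_b] b_lo a by (auto simp: b_def)
  moreover have "b \<le> J b"
    using rel_iff[OF tr J_le] trans[OF t_b b_lo] inj_b[OF tr t_b] b_lo by (auto simp: b_def)
  moreover have "J (Suc b) \<le> b"
    using rel_iff[OF a(2) J_le] trans[OF a_b b_hi] inj_b[OF a(2) a_b] b_hi a by (auto simp: b_def)
  moreover have "J b \<le> J (Suc b)" by (rule J_mono) simp
  ultimately have "J b = b" "J (Suc b) = b" by auto
  then show "1 \<le> j t \<Longrightarrow> j (j t) = j t" "j t < r \<Longrightarrow> j (Suc (j t)) = j t"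
    using b by (auto simp: J_def split: if_splits)
qed

text \<open>Without comparable elements there is no chain \<open>x < y\<close> to test the order
  axioms on. But then all multichains are constant and evaluation at 1 has one-element fibres, for
  any \<open>\<iota>\<close>.\<close>

lemma multichain_rel_antichain:
  fixes P :: "'a set"
  assumes P: "finite P" "partial_order_on P R" and r: "r \<ge> 1"
    and Q: "partial_order_on (multichains P R r) (multichain_rel P R r \<iota>)"
    and anti: "\<And>x y. (x, y) \<in> R \<Longrightarrow> x = y"
  shows "geometric_realization (order_complex (multichains P R r) (multichain_rel P R r \<iota>))
         homotopy_equivalent_space geometric_realization (order_complex P R)"
proof (rule quillen_fibre[of _ _ _ _ "\<lambda>p. p 1"])
  note refl = partial_order_onD(1)[OF P(2), unfolded refl_on_def, rule_format]
  have const: "p = (\<lambda>t\<in>{1..r}. p 1)" "p 1 \<in> P" if "p \<in> multichains P R r" for p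
  proof -
    have "p 1 = p t" if "t \<in> {1..r}" for t
      using \<open>p \<in> _\<close> r that anti unfolding multichains_def by auto
    then show "p = (\<lambda>t\<in>{1..r}. p 1)"
      using \<open>p \<in> _\<close> unfolding multichains_def by (auto simp: fun_eq_iff PiE_def extensional_def)
    show "p 1 \<in> P" using \<open>p \<in> _\<close> r unfolding multichains_def by auto
  qed
  show "finite (multichains P R r)" using P(1) by (simp add: multichains_eq finite_monotone_families)
  show "p 1 \<in> P" if "p \<in> multichains P R r" for p using const(2) that .
  show "(p 1, q 1) \<in> R" if pq: "(p, q) \<in> multichain_rel P R r \<iota>" for p q
  proof -
    have pq': "p \<in> multichains P R r" "q \<in> multichains P R r" using pq unfolding multichain_rel_def by auto
    have "p = q \<or> multichain_prec R r \<iota> p q" using pq unfolding multichain_rel_def by auto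
    then have "p 1 = q 1"
    proof
      assume "multichain_prec R r \<iota> p q"
      then have "(q 1, p 1) \<in> R \<or> (p 1, q 1) \<in> R"
        using r unfolding multichain_prec_def by (meson atLeastAtMost_iff le_refl not_le)
      then show ?thesis using anti by metis
    qed simp
    then show ?thesis using refl const(2) pq' by metis
  qed
  show "conically_contractible {p \<in> multichains P R r. (y, p 1) \<in> R} (multichain_rel P R r \<iota>)"
    if y: "y \<in> P" for y
  proof (rule conically_contractible_least)
    show mem: "(\<lambda>t\<in>{1..r}. y) \<in> {p \<in> multichains P R r. (y, p 1) \<in> R}"
      using y refl r unfolding multichains_def by auto
    fix p assume "p \<in> {p \<in> multichains P R r. (y, p 1) \<in> R}"
    then have "p = (\<lambda>t\<in>{1..r}. y)" "p \<in> multichains P R r" using const(1) anti by blast+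
    then show "((\<lambda>t\<in>{1..r}. y), p) \<in> multichain_rel P R r \<iota>"
      unfolding multichain_rel_def by auto
  qed
qed (use P Q in auto)

theorem theorem1p3:
  fixes P :: "'a set" and R :: "'a rel" and r :: nat and \<iota> :: "nat \<Rightarrow> nat"
  assumes "finite P" and "partial_order_on P R"
    and "r \<ge> 1"
    and "\<iota> \<in> {1..r} \<rightarrow> {1..2 * r}" and "strict_mono_on {1..r} \<iota>"
    and "partial_order_on (multichains P R r) (multichain_rel P R r \<iota>)"
  shows "geometric_realization (order_complex (multichains P R r) (multichain_rel P R r \<iota>))
           homotopy_equivalent_space geometric_realization (order_complex P R)"
proof (cases "\<exists>x y. (x, y) \<in> R \<and> x \<noteq> y")
  case False
  then show ?thesis using multichain_rel_antichain assms by blast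
next
  case True
  then obtain x y where xy: "(x, y) \<in> R" "x \<noteq> y" by blast
  define j where "j t = \<iota> t - t" for t
  \<comment> \<open>A strictly increasing integer function grows at least as fast as its argument.
    Hence \<open>j\<close> is weakly increasing, while \<open>1 \<le> \<iota> 1\<close> keeps the
    subtraction exact and \<open>\<iota> r \<le> 2 * r\<close> bounds \<open>j\<close> by
    \<open>r\<close>.\<close>
  have step: "\<iota> s + (t - s) \<le> \<iota> t" if "s \<in> {1..r}" "t \<in> {1..r}" "s \<le> t" for s t
    using that(3,2)
  proof (induction t rule: dec_induct)
    case (step t)
    then have "\<iota> t < \<iota> (Suc t)"
      using that(1) strict_mono_onD[OF assms(5), of t "Suc t"] by auto
    then show ?case using step that(1) by auto
  qed simp
  have ge: "t \<le> \<iota> t" if "t \<in> {1..r}" for t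
  proof -
    have "1 \<le> \<iota> 1" using assms(3,4) by (auto simp: Pi_iff)
    then show ?thesis using step[of 1 t] that by auto
  qed
  have j_le: "j t \<le> r" if "t \<in> {1..r}" for t
  proof -
    have "\<iota> r \<le> 2 * r" using assms(3,4) by (auto simp: Pi_iff)
    then show ?thesis using step[of t r] that unfolding j_def by auto
  qed
  have j_mono: "j s \<le> j t" if "s \<in> {1..r}" "t \<in> {1..r}" "s \<le> t" for s t
    using step[OF that] ge[OF that(1)] that unfolding j_def by auto
  note stable = multichain_rel_partial_order_stable[OF assms(2,6) _ j_le j_mono xy, OF j_def[symmetric]]
  define T where "T = {t \<in> {1..r}. j t = t \<or> Suc (j t) = t}"
  \<comment> \<open>If \<open>j 1 = 0\<close>, then 1 is in \<open>T\<close> as a successor;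
    otherwise \<open>j 1\<close> is in \<open>T\<close> as a fixed point of
    \<open>j\<close>.\<close>
  have "T \<noteq> {}"
  proof (cases "j 1 = 0")
    case True
    then show ?thesis using assms(3) unfolding T_def by auto
  next
    case False
    then show ?thesis using stable(1)[of 1] j_le[of 1] assms(3) unfolding T_def by force
  qed
  moreover have "finite T" unfolding T_def by simp
  ultimately show ?thesis
    using homotopy_eqv_trans[OF multichain_rel_reduce[OF assms(1,2,6) _ j_le j_mono stable T_def, OF j_def[symmetric]]
        signed_rel_homotopy_equivalent[OF assms(1,2)]] by blast
qed

end
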